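(* Let $n\geqslant 0$ be an integer. (i) $Q_0(n)$ and $pod(n)$ have the same parity. (ii) $Q_2(n)$ and $b_4(n)$ have the same parity.
   Context: A partition of $n$ is a nonincreasing sequence of positive integers (called parts) with sum $n$; the empty partition is the only partition of $0$. For $k\in\{0,2\}$, $Q_k(n)$ is the number of partitions of $n$ into distinct parts none of which is congruent to $k$ modulo $4$. $pod(n)$ is the number of partitions of $n$ in which odd parts are distinct and even parts are unrestricted (equivalently, the number of partitions of $n$ into parts not congruent to $2$ modulo $4$). $b_4(n)$ is the number of $4$-regular partitions of $n$, i.e. partitions of $n$ with no part divisible by $4$. *)

theory Defs
  imports "HOL-Number_Theory.Cong"
begin

definition partitions :: "nat \<Rightarrow> nat list set" where
  "partitions n = {xs. sorted_wrt (\<ge>) xs \<and> (\<forall>x\<in>set xs. x > 0) \<and> sum_list xs = n}"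

(* Finiteness guarantees that the cardinalities below are genuine counts. *)
lemma finite_partitions: "finite (partitions n)"
proof -
  have "length xs \<le> sum_list xs" if "\<forall>x\<in>set xs. x > 0" for xs :: "nat list"
    using that by (induction xs) auto
  moreover have "set xs \<subseteq> {..sum_list xs}" for xs :: "nat list"
    using member_le_sum_list by blast
  ultimately have "partitions n \<subseteq> {xs. set xs \<subseteq> {..n} \<and> length xs \<le> n}"
    unfolding partitions_def by blast
  then show ?thesis
    using finite_lists_length_le[of "{..n}" n] finite_subset by blast
qed

definition Q :: "nat \<Rightarrow> nat \<Rightarrow> nat" where
  "Q k n = card {xs \<in> partitions n. distinct xs \<and> (\<forall>x\<in>set xs. \<not> [x = k] (mod 4))}"

definition pod :: "nat \<Rightarrow> nat" where
  "pod n = card {xs \<in> partitions n. distinct (filter odd xs)}"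

definition b4 :: "nat \<Rightarrow> nat" where
  "b4 n = card {xs \<in> partitions n. \<forall>x\<in>set xs. \<not> 4 dvd x}"

end

theory Submission
  imports Defs "HOL-Library.Z2" "HOL-Computational_Algebra.Formal_Power_Series"
begin

text \<open>
  The proof compares generating functions modulo \<open>2\<close>, that is, as power series over the
  two-element field. A class of partitions that restricts the multiplicity of each part
  separately has a product as its generating function (\<open>of_nat_card_restricted_partitions\<close>),
  with factor \<open>1 + X^i\<close> for a part \<open>i\<close> that occurs at most once and \<open>1 / (1 + X^i)\<close> for a part
  that is unrestricted. Write \<open>D S\<close> for the product of \<open>1 + X^i\<close> over \<open>i\<close> in \<open>S\<close>. With all parts
  bounded by \<open>n\<close>, and \<open>S\<^sub>1\<close>, \<open>S\<^sub>2\<close>, \<open>S\<^sub>4\<close>, \<open>E\<close> the sets of bounded parts that are odd, \<open>2\<close> modulo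
  \<open>4\<close>, \<open>0\<close> modulo \<open>4\<close>, and even, the four generating functions are
  \<open>D S\<^sub>1 * D S\<^sub>2\<close>, \<open>D S\<^sub>1 / D E\<close>, \<open>D S\<^sub>1 * D S\<^sub>4\<close> and \<open>1 / (D S\<^sub>1 * D S\<^sub>2)\<close>, in the order
  \<open>Q\<^sub>0\<close>, \<open>pod\<close>, \<open>Q\<^sub>2\<close>, \<open>b\<^sub>4\<close>.

  Hence \<open>Q\<^sub>0 / pod = D S\<^sub>2 * D E\<close> and \<open>Q\<^sub>2 / b\<^sub>4 = (D S\<^sub>1)^2 * D E\<close>. In characteristic \<open>2\<close> squaring
  \<open>D S\<close> doubles every element of \<open>S\<close>. Multiplying the first quotient by \<open>D S\<^sub>4\<close> therefore gives
  \<open>(D E)^2\<close>, the product over the multiples of \<open>4\<close> up to \<open>2n\<close>; multiplying the second by \<open>D E\<close>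
  gives \<open>(D S\<^sub>1)^2 * (D E)^2\<close>, the product over the even numbers up to \<open>2n\<close>. After cancellation,
  both quotients are products of \<open>1 + X^i\<close> with \<open>i > n\<close> only, so they do not affect the
  coefficient of \<open>X^n\<close>. This is Euler's theorem on distinct and odd parts, read modulo \<open>2\<close>, in
  a truncated form that needs no infinite products.
\<close>

section \<open>Partitions with restricted multiplicities\<close>

definition restricted_partitions :: "(nat \<Rightarrow> nat set) \<Rightarrow> nat \<Rightarrow> nat \<Rightarrow> nat list set" where
  "restricted_partitions M N n =
     {xs \<in> partitions n. set xs \<subseteq> {1..N} \<and> (\<forall>i\<in>{1..N}. count_list xs i \<in> M i)}"

definition part_gf :: "nat \<Rightarrow> nat set \<Rightarrow> 'a::comm_semiring_1 fps" where
  "part_gf i M = Abs_fps (\<lambda>k. of_bool (i dvd k \<and> k div i \<in> M))"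

lemma count_list_replicate:
  "count_list (replicate m a) b = (if a = b then m else 0)"
  by (induction m) auto

lemma count_list_filter:
  "count_list (filter P xs) x = (if P x then count_list xs x else 0)"
  by (induction xs) auto

lemma sorted_desc_replicate: "sorted_wrt (\<ge>) (replicate m (a :: 'a::preorder))"
  by (induction m) auto

lemma sorted_desc_split_maximum:
  fixes xs :: "'a::linorder list"
  assumes "sorted_wrt (\<ge>) xs" "\<forall>x\<in>set xs. x \<le> a"
  shows "replicate (count_list xs a) a @ filter (\<lambda>x. x \<noteq> a) xs = xs"
  using assms
proof (induction xs)
  case (Cons x xs)
  show ?case
  proof (cases "x = a")
    case False
    then have "a \<notin> set xs" using Cons.prems by auto
    with False show ?thesis by (auto intro!: filter_True)
  qed (use Cons in auto)
qed simp

text \<open>Sorting puts the copies of the part \<open>N + 1\<close> in front, so deleting them is a bijection that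
  keeps every other multiplicity. In terms of generating functions it splits off the last
  factor; \<open>k\<close> is the amount that these copies contribute to \<open>n\<close>.\<close>

lemma card_restricted_partitions_fibre:
  assumes "k \<le> n"
  shows "card {xs \<in> restricted_partitions M (Suc N) n. count_list xs (Suc N) * Suc N = k} =
    (if Suc N dvd k \<and> k div Suc N \<in> M (Suc N) then card (restricted_partitions M N (n - k)) else 0)"
    (is "card ?A = _")
proof (cases "Suc N dvd k \<and> k div Suc N \<in> M (Suc N)")
  case True
  define m where "m = k div Suc N"
  have km: "k = m * Suc N" using True by (simp only: m_def dvd_div_mult_self)
  have "bij_betw (\<lambda>ys. replicate m (Suc N) @ ys) (restricted_partitions M N (n - k)) ?A"
  proof (rule bij_betw_byWitness[where f' = "filter (\<lambda>x. x \<noteq> Suc N)"])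
    show "\<forall>ys\<in>restricted_partitions M N (n - k).
            filter (\<lambda>x. x \<noteq> Suc N) (replicate m (Suc N) @ ys) = ys"
      by (force simp: restricted_partitions_def intro!: filter_True)
    have split: "replicate m (Suc N) @ filter (\<lambda>x. x \<noteq> Suc N) xs = xs" if "xs \<in> ?A" for xs
    proof -
      have "count_list xs (Suc N) = m"
        using that unfolding km by (simp del: mult_Suc_right)
      moreover have "sorted_wrt (\<ge>) xs" "\<forall>x\<in>set xs. x \<le> Suc N"
        using that by (auto simp: restricted_partitions_def partitions_def)
      ultimately show ?thesis
        using sorted_desc_split_maximum[of xs "Suc N"] by simp
    qed
    then show "\<forall>xs\<in>?A. replicate m (Suc N) @ filter (\<lambda>x. x \<noteq> Suc N) xs = xs" by blast
    show "(\<lambda>ys. replicate m (Suc N) @ ys) ` restricted_partitions M N (n - k) \<subseteq> ?A"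
    proof clarify
      fix ys assume ys: "ys \<in> restricted_partitions M N (n - k)"
      then have ys': "sorted_wrt (\<ge>) ys" "set ys \<subseteq> {1..N}" "sum_list ys = n - k"
        "\<forall>i\<in>{1..N}. count_list ys i \<in> M i"
        by (auto simp: restricted_partitions_def partitions_def)
      then have max: "count_list ys (Suc N) = 0"
        by (intro count_notin) auto
      have "sorted_wrt (\<ge>) (replicate m (Suc N) @ ys)"
        using ys' by (force simp: sorted_wrt_append sorted_desc_replicate)
      moreover have "sum_list (replicate m (Suc N) @ ys) = n"
        using ys' assms by (simp add: sum_list_replicate km)
      moreover have "set (replicate m (Suc N) @ ys) \<subseteq> {1..Suc N}"
        using ys' by auto
      moreover have "count_list (replicate m (Suc N) @ ys) i \<in> M i" if "i \<in> {1..Suc N}" for i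
        using that ys' max True
        by (cases "i = Suc N") (auto simp: count_list_replicate m_def)
      moreover have "\<forall>x\<in>set (replicate m (Suc N) @ ys). x > 0"
        using ys'(2) by force
      moreover have "count_list (replicate m (Suc N) @ ys) (Suc N) * Suc N = k"
        by (simp only: count_list_append count_list_replicate max km if_True add_0_right refl)
      ultimately show "replicate m (Suc N) @ ys \<in> restricted_partitions M (Suc N) n \<and>
          count_list (replicate m (Suc N) @ ys) (Suc N) * Suc N = k"
        unfolding restricted_partitions_def partitions_def by blast
    qed
    show "filter (\<lambda>x. x \<noteq> Suc N) ` ?A \<subseteq> restricted_partitions M N (n - k)"
    proof clarify
      fix xs assume xs: "xs \<in> restricted_partitions M (Suc N) n" "k = count_list xs (Suc N) * Suc N"
      let ?ys = "filter (\<lambda>x. x \<noteq> Suc N) xs"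
      have "sum_list xs = sum_list (replicate m (Suc N) @ ?ys)"
        using split[of xs] xs by simp
      also have "\<dots> = k + sum_list ?ys"
        by (simp add: sum_list_replicate km)
      finally have "sum_list xs = k + sum_list ?ys" .
      moreover have "sum_list xs = n"
        using xs(1) by (simp add: restricted_partitions_def partitions_def)
      ultimately have "sum_list ?ys = n - k" by linarith
      moreover have "set ?ys \<subseteq> {1..N}"
        using xs(1) by (force simp: restricted_partitions_def)
      ultimately have "?ys \<in> restricted_partitions M N (n - k)"
        using xs(1) by (auto simp: restricted_partitions_def partitions_def count_list_filter
            sorted_wrt_filter)
      then show "?ys \<in> restricted_partitions M N (n - count_list xs (Suc N) * Suc N)"
        using xs(2) by simp
    qed
  qed
  with True show ?thesis by (simp add: bij_betw_same_card)
next
  case False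
  have "?A = {}"
  proof -
    have "count_list xs (Suc N) * Suc N \<noteq> k" if "xs \<in> restricted_partitions M (Suc N) n" for xs
    proof
      assume k: "count_list xs (Suc N) * Suc N = k"
      then have "k div Suc N = count_list xs (Suc N)"
        by (metis nonzero_mult_div_cancel_right nat.distinct(1))
      moreover have "Suc N dvd k" using k by (metis dvd_triv_right)
      ultimately show False using that False by (auto simp: restricted_partitions_def)
    qed
    then show ?thesis by blast
  qed
  with False show ?thesis by (simp only: card.empty if_False)
qed

lemma finite_restricted_partitions: "finite (restricted_partitions M N n)"
  by (rule finite_subset[OF _ finite_partitions[of n]]) (auto simp: restricted_partitions_def)

lemma multiplicity_times_part_le_sum_list:
  fixes xs :: "nat list"
  shows "count_list xs a * a \<le> sum_list xs"
  by (induction xs) auto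

theorem of_nat_card_restricted_partitions:
  "(of_nat (card (restricted_partitions M N n)) :: 'a::comm_semiring_1) =
     fps_nth (\<Prod>i=1..N. part_gf i (M i)) n"
proof (induction N arbitrary: n)
  case 0
  have "restricted_partitions M 0 n = (if n = 0 then {[]} else {})"
    by (auto simp: restricted_partitions_def partitions_def)
  then show ?case by simp
next
  case (Suc N)
  let ?R = "restricted_partitions M (Suc N) n"
  have "card ?R = card (\<Union>k\<in>{0..n}. {xs \<in> ?R. count_list xs (Suc N) * Suc N = k})"
    using multiplicity_times_part_le_sum_list
    by (intro arg_cong[where f = card])
       (force simp del: mult_Suc_right simp: restricted_partitions_def partitions_def)
  also have "\<dots> = (\<Sum>k=0..n. card {xs \<in> ?R. count_list xs (Suc N) * Suc N = k})"
    by (rule card_UN_disjoint) (auto simp: finite_restricted_partitions)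
  also have "(of_nat \<dots> :: 'a) =
      (\<Sum>k=0..n. of_bool (Suc N dvd k \<and> k div Suc N \<in> M (Suc N)) *
         of_nat (card (restricted_partitions M N (n - k))))"
    unfolding of_nat_sum
    by (intro sum.cong refl) (subst card_restricted_partitions_fibre, auto)
  also have "\<dots> = fps_nth (part_gf (Suc N) (M (Suc N)) * (\<Prod>i=1..N. part_gf i (M i))) n"
    by (simp add: fps_mult_nth part_gf_def Suc.IH)
  finally show ?case by (simp add: mult.commute)
qed

lemma part_gf_absent: "i > 0 \<Longrightarrow> part_gf i {0} = 1"
  by (rule fps_ext) (auto simp: part_gf_def)

lemma part_gf_at_most_once:
  assumes "i > 0"
  shows "part_gf i {0, 1} = 1 + fps_X ^ i"
  using assms by (intro fps_ext) (auto simp: part_gf_def fps_X_power_nth)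

text \<open>The left-hand side is a geometric series times \<open>1 - X^i\<close>.\<close>

lemma part_gf_unrestricted:
  fixes i :: nat
  assumes "i > 0"
  shows "part_gf i UNIV * (1 - fps_X ^ i) = (1 :: 'a::comm_ring_1 fps)"
proof (rule fps_ext)
  fix k
  show "fps_nth (part_gf i UNIV * (1 - fps_X ^ i)) k = fps_nth (1 :: 'a fps) k"
    using assms
    by (auto simp: part_gf_def right_diff_distrib fps_X_power_mult_right_nth dvd_minus_self
        dest: dvd_imp_le)
qed

section \<open>Products over the two-element field\<close>

definition distinct_gf :: "nat set \<Rightarrow> bit fps" where
  "distinct_gf S = (\<Prod>i\<in>S. 1 + fps_X ^ i)"

definition unrestricted_gf :: "nat set \<Rightarrow> bit fps" where
  "unrestricted_gf S = (\<Prod>i\<in>S. part_gf i UNIV)"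

lemma distinct_gf_Un_disjoint:
  "finite S \<Longrightarrow> finite T \<Longrightarrow> S \<inter> T = {} \<Longrightarrow> distinct_gf (S \<union> T) = distinct_gf S * distinct_gf T"
  unfolding distinct_gf_def by (rule prod.union_disjoint)

lemma bit_fps_add_self: "(f :: bit fps) + f = 0"
  by (rule fps_ext, subst fps_add_nth, simp)

lemma bit_fps_uminus: "- (f :: bit fps) = f"
  by (rule fps_ext) simp

lemma unrestricted_gf_mult_distinct_gf:
  assumes "0 \<notin> S"
  shows "unrestricted_gf S * distinct_gf S = 1"
proof -
  have "part_gf i UNIV * (1 + fps_X ^ i) = (1 :: bit fps)" if "i \<in> S" for i
  proof -
    from that assms have "i > 0" by (cases "i = 0") auto
    moreover have "1 - fps_X ^ i = (1 + fps_X ^ i :: bit fps)"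
      by (metis diff_conv_add_uminus bit_fps_uminus)
    ultimately show ?thesis
      using part_gf_unrestricted[of i, where ?'a = bit] by metis
  qed
  then show ?thesis
    by (simp add: unrestricted_gf_def distinct_gf_def flip: prod.distrib)
qed

lemma distinct_gf_nonzero: "0 \<notin> S \<Longrightarrow> distinct_gf S \<noteq> 0"
  using unrestricted_gf_mult_distinct_gf[of S] by auto

lemma distinct_gf_square: "distinct_gf S * distinct_gf S = distinct_gf ((*) 2 ` S)"
proof -
  have "(1 + fps_X ^ i) * (1 + fps_X ^ i) = (1 + fps_X ^ (2 * i) :: bit fps)" for i
  proof -
    have "(1 + fps_X ^ i) * (1 + fps_X ^ i) =
        1 + (fps_X ^ i + fps_X ^ i) + (fps_X ^ (2 * i) :: bit fps)"
      by (simp only: distrib_left distrib_right mult_1 mult_1_right mult_2 power_add add.assoc)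
    then show ?thesis by (simp add: bit_fps_add_self)
  qed
  then show ?thesis
    by (simp add: distinct_gf_def prod.reindex inj_on_def flip: prod.distrib)
qed

lemma nth_mult_distinct_gf_large:
  assumes "finite S" "\<forall>i\<in>S. n < i"
  shows "fps_nth (f * distinct_gf S) n = fps_nth f n"
  using assms
proof (induction S)
  case (insert i S)
  have "fps_nth (f * distinct_gf (insert i S)) n =
      fps_nth (f * distinct_gf S + (f * distinct_gf S) * fps_X ^ i) n"
    using insert by (simp add: distinct_gf_def algebra_simps)
  also have "\<dots> = fps_nth f n"
    using insert by (simp add: fps_X_power_mult_right_nth)
  finally show ?case .
qed (simp add: distinct_gf_def)

section \<open>Parity of the coefficients\<close>

text \<open>This is the common shape of both comparisons: \<open>F\<close> and \<open>G\<close> have quotient \<open>H\<close>, and \<open>H\<close> is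
  a product over large exponents because the factors \<open>D T\<close> cancel.\<close>

lemma nth_eq_if_quotient_large:
  assumes "F = G * H" "H * distinct_gf T = distinct_gf (T \<union> L)"
    and "finite T" "0 \<notin> T" "finite L" "\<forall>i\<in>T. i \<le> n" "\<forall>i\<in>L. n < i"
  shows "fps_nth F n = fps_nth G n"
proof -
  have "T \<inter> L = {}"
    using assms(6,7) by force
  then have "distinct_gf (T \<union> L) = distinct_gf L * distinct_gf T"
    using assms by (simp add: distinct_gf_Un_disjoint mult.commute)
  then have "H = distinct_gf L"
    using assms(2) distinct_gf_nonzero[OF assms(4)] by simp
  then show ?thesis
    using assms(1) nth_mult_distinct_gf_large[OF assms(5,7)] by simp
qed

lemma odd_iff_of_nat_bit: "odd m \<longleftrightarrow> (of_nat m :: bit) = 1"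
  by (induction m) auto

lemma partitions_parts_subset:
  assumes "xs \<in> partitions n"
  shows "set xs \<subseteq> {1..n}"
proof
  fix x assume "x \<in> set xs"
  then show "x \<in> {1..n}"
    using assms member_le_sum_list[of x xs] by (auto simp: partitions_def Suc_le_eq)
qed

lemma distinct_iff_count_list_le_1: "distinct xs \<longleftrightarrow> (\<forall>x. count_list xs x \<in> {0, 1})"
proof (induction xs)
  case (Cons a xs)
  have "count_list (a # xs) x \<in> {0, 1} \<longleftrightarrow>
      (if x = a then count_list xs a = 0 else count_list xs x \<in> {0, 1})" for x
    by simp
  moreover have "count_list xs a = 0 \<longleftrightarrow> a \<notin> set xs"
    by (rule count_list_0_iff)
  ultimately show ?case
    unfolding distinct.simps Cons.IH by (metis insertCI)
qed simp

text \<open>For a partition of \<open>n\<close> the bound \<open>n\<close> on the parts is automatic, so a multiplicity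
  condition imposed at every number is the same as one imposed up to \<open>n\<close>.\<close>

lemma restricted_partitions_eq_Collect:
  assumes "\<And>i. 0 \<in> M i"
  shows "restricted_partitions M n n = {xs \<in> partitions n. \<forall>i. count_list xs i \<in> M i}"
proof -
  have "count_list xs i \<in> M i"
    if "xs \<in> partitions n" "\<forall>i\<in>{1..n}. count_list xs i \<in> M i" for xs i
    using that assms partitions_parts_subset[of xs n] by (cases "i \<in> set xs") auto
  then show ?thesis
    using partitions_parts_subset unfolding restricted_partitions_def by blast
qed

lemma of_nat_Q:
  "of_nat (Q k n) = fps_nth (distinct_gf {i \<in> {1..n}. \<not> [i = k] (mod 4)}) n"
proof -
  let ?M = "\<lambda>i::nat. if [i = k] (mod 4) then {0} else {0, 1::nat}"
  have "count_list xs i \<in> ?M i \<longleftrightarrow>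
      count_list xs i \<in> {0, 1} \<and> (i \<in> set xs \<longrightarrow> \<not> [i = k] (mod 4))" for xs i
    using count_list_0_iff[of xs i] by (cases "[i = k] (mod 4)"; cases "i \<in> set xs") simp_all
  then have "(distinct xs \<and> (\<forall>x\<in>set xs. \<not> [x = k] (mod 4))) \<longleftrightarrow>
      (\<forall>i. count_list xs i \<in> ?M i)" for xs
    unfolding distinct_iff_count_list_le_1 by blast
  then have "Q k n = card (restricted_partitions ?M n n)"
    by (simp add: Q_def restricted_partitions_eq_Collect)
  moreover have "(\<Prod>i=1..n. part_gf i (?M i)) = distinct_gf {i \<in> {1..n}. \<not> [i = k] (mod 4)}"
    unfolding distinct_gf_def
    by (subst prod.inter_filter)
       (auto intro!: prod.cong simp: part_gf_absent part_gf_at_most_once[unfolded One_nat_def])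
  ultimately show ?thesis
    using of_nat_card_restricted_partitions[of ?M n n, where ?'a = bit] by simp
qed

lemma of_nat_pod:
  "of_nat (pod n) =
     fps_nth (distinct_gf {i \<in> {1..n}. odd i} * unrestricted_gf {i \<in> {1..n}. even i}) n"
proof -
  let ?M = "\<lambda>i::nat. if odd i then {0, 1::nat} else UNIV"
  have "count_list (filter odd xs) i \<in> {0, 1} \<longleftrightarrow> count_list xs i \<in> ?M i" for xs i
    by (simp add: count_list_filter)
  then have "distinct (filter odd xs) \<longleftrightarrow> (\<forall>i. count_list xs i \<in> ?M i)" for xs
    unfolding distinct_iff_count_list_le_1 by blast
  then have "pod n = card (restricted_partitions ?M n n)"
    by (simp add: pod_def restricted_partitions_eq_Collect)
  moreover have "(\<Prod>i=1..n. part_gf i (?M i)) =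
      distinct_gf {i \<in> {1..n}. odd i} * unrestricted_gf {i \<in> {1..n}. even i}"
    unfolding distinct_gf_def unrestricted_gf_def
    by (subst (1 2) prod.inter_filter)
       (auto intro!: prod.cong simp: part_gf_at_most_once[unfolded One_nat_def] simp flip: prod.distrib)
  ultimately show ?thesis
    using of_nat_card_restricted_partitions[of ?M n n, where ?'a = bit] by simp
qed

lemma of_nat_b4:
  "of_nat (b4 n) = fps_nth (unrestricted_gf {i \<in> {1..n}. \<not> 4 dvd i}) n"
proof -
  let ?M = "\<lambda>i::nat. if 4 dvd i then {0} else (UNIV :: nat set)"
  have "count_list xs i \<in> ?M i \<longleftrightarrow> (i \<in> set xs \<longrightarrow> \<not> 4 dvd i)" for xs i
    using count_list_0_iff[of xs i] by simp
  then have "(\<forall>x\<in>set xs. \<not> 4 dvd x) \<longleftrightarrow> (\<forall>i. count_list xs i \<in> ?M i)" for xs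
    by blast
  then have "b4 n = card (restricted_partitions ?M n n)"
    by (simp add: b4_def restricted_partitions_eq_Collect)
  moreover have "(\<Prod>i=1..n. part_gf i (?M i)) = unrestricted_gf {i \<in> {1..n}. \<not> 4 dvd i}"
    unfolding unrestricted_gf_def
    by (subst prod.inter_filter) (auto intro!: prod.cong simp: part_gf_absent)
  ultimately show ?thesis
    using of_nat_card_restricted_partitions[of ?M n n, where ?'a = bit] by simp
qed

text \<open>The doubled bounded even numbers are the multiples of \<open>4\<close> up to \<open>2n\<close>; those up to \<open>n\<close> form
  \<open>S\<^sub>4\<close>, the part of \<open>E\<close> that the quotient of the two generating functions lacks.\<close>

lemma of_nat_Q_0_eq_of_nat_pod: "(of_nat (Q 0 n) :: bit) = of_nat (pod n)"
proof -
  define S1 where "S1 = {i \<in> {1..n}. odd i}"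
  define S2 where "S2 = {i \<in> {1..n}. i mod 4 = 2}"
  define S4 where "S4 = {i \<in> {1..n}. 4 dvd i}"
  define E where "E = {i \<in> {1..n}. even i}"
  define L where "L = {i \<in> {n<..2*n}. 4 dvd i}"
  have fin: "finite S1" "finite S2" "finite S4" "finite E" "finite L"
    by (auto simp: S1_def S2_def S4_def E_def L_def)
  have "{i \<in> {1..n}. \<not> [i = 0] (mod 4)} = S1 \<union> S2"
    unfolding S1_def S2_def cong_def by (auto; presburger)
  moreover have "S1 \<inter> S2 = {}"
    unfolding S1_def S2_def by (auto; presburger)
  ultimately have Q: "distinct_gf {i \<in> {1..n}. \<not> [i = 0] (mod 4)} = distinct_gf S1 * distinct_gf S2"
    using fin by (simp add: distinct_gf_Un_disjoint)
  have "E = S2 \<union> S4"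
    unfolding E_def S2_def S4_def by (auto; presburger)
  moreover have "S2 \<inter> S4 = {}"
    unfolding S2_def S4_def by auto
  ultimately have E: "distinct_gf E = distinct_gf S2 * distinct_gf S4"
    using fin by (simp add: distinct_gf_Un_disjoint)
  have "(*) 2 ` E = S4 \<union> L"
  proof
    show "S4 \<union> L \<subseteq> (*) 2 ` E"
    proof
      fix i assume "i \<in> S4 \<union> L"
      then have "i = 2 * (i div 2)" "i div 2 \<in> E"
        by (auto simp: S4_def L_def E_def)
      then show "i \<in> (*) 2 ` E" by blast
    qed
  qed (auto simp: E_def S4_def L_def)
  then have sq: "distinct_gf E * distinct_gf E = distinct_gf (S4 \<union> L)"
    by (simp add: distinct_gf_square)
  have "fps_nth (distinct_gf S1 * distinct_gf S2) n = fps_nth (distinct_gf S1 * unrestricted_gf E) n"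
  proof (rule nth_eq_if_quotient_large)
    have "unrestricted_gf E * distinct_gf E = 1"
      by (rule unrestricted_gf_mult_distinct_gf) (simp add: E_def)
    then show "distinct_gf S1 * distinct_gf S2 =
        distinct_gf S1 * unrestricted_gf E * (distinct_gf E * distinct_gf S2)"
      by (metis mult.assoc mult.commute mult.right_neutral)
    show "distinct_gf E * distinct_gf S2 * distinct_gf S4 = distinct_gf (S4 \<union> L)"
      using sq E by (simp add: mult.assoc)
  qed (use fin in \<open>auto simp: S4_def L_def\<close>)
  then show ?thesis
    using Q of_nat_Q of_nat_pod by (simp add: S1_def E_def)
qed

text \<open>The quotient \<open>(D S\<^sub>1)^2 * D E\<close> falls short of \<open>(D {1..n})^2\<close> by one factor \<open>D E\<close>, and this
  factor is also the product over the even numbers up to \<open>n\<close> among those up to \<open>2n\<close>.\<close>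

lemma of_nat_Q_2_eq_of_nat_b4: "(of_nat (Q 2 n) :: bit) = of_nat (b4 n)"
proof -
  define S1 where "S1 = {i \<in> {1..n}. odd i}"
  define S2 where "S2 = {i \<in> {1..n}. i mod 4 = 2}"
  define S4 where "S4 = {i \<in> {1..n}. 4 dvd i}"
  define E where "E = {i \<in> {1..n}. even i}"
  define L where "L = {i \<in> {n<..2*n}. even i}"
  have fin: "finite S1" "finite S2" "finite S4" "finite E" "finite L"
    by (auto simp: S1_def S2_def S4_def E_def L_def)
  have "{i \<in> {1..n}. \<not> [i = 2] (mod 4)} = S1 \<union> S4"
    unfolding S1_def S4_def cong_def by (auto; presburger)
  moreover have "S1 \<inter> S4 = {}"
    unfolding S1_def S4_def by (auto; presburger)
  ultimately have Q: "distinct_gf {i \<in> {1..n}. \<not> [i = 2] (mod 4)} = distinct_gf S1 * distinct_gf S4"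
    using fin by (simp add: distinct_gf_Un_disjoint)
  define R where "R = {i \<in> {1..n}. \<not> 4 dvd i}"
  have "R = S1 \<union> S2"
    unfolding R_def S1_def S2_def by (auto; presburger)
  moreover have "S1 \<inter> S2 = {}"
    unfolding S1_def S2_def by (auto; presburger)
  ultimately have R: "distinct_gf R = distinct_gf S1 * distinct_gf S2"
    using fin by (simp add: distinct_gf_Un_disjoint)
  have "E = S2 \<union> S4"
    unfolding E_def S2_def S4_def by (auto; presburger)
  moreover have "S2 \<inter> S4 = {}"
    unfolding S2_def S4_def by auto
  ultimately have E: "distinct_gf E = distinct_gf S2 * distinct_gf S4"
    using fin by (simp add: distinct_gf_Un_disjoint)
  have "S1 \<inter> E = {}" "S1 \<union> E = {1..n}"
    unfolding S1_def E_def by auto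
  then have all: "distinct_gf {1..n} = distinct_gf S1 * distinct_gf E"
    using fin distinct_gf_Un_disjoint by metis
  have "(*) 2 ` {1..n} = E \<union> L"
  proof
    show "E \<union> L \<subseteq> (*) 2 ` {1..n}"
    proof
      fix i assume "i \<in> E \<union> L"
      then have "i = 2 * (i div 2)" "i div 2 \<in> {1..n}"
        by (auto simp: L_def E_def)
      then show "i \<in> (*) 2 ` {1..n}" by blast
    qed
  qed (auto simp: E_def L_def)
  then have sq: "distinct_gf {1..n} * distinct_gf {1..n} = distinct_gf (E \<union> L)"
    by (simp add: distinct_gf_square)
  have "fps_nth (distinct_gf S1 * distinct_gf S4) n = fps_nth (unrestricted_gf R) n"
  proof (rule nth_eq_if_quotient_large)
    have "unrestricted_gf R * distinct_gf R = 1"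
      by (rule unrestricted_gf_mult_distinct_gf) (simp add: R_def)
    moreover have "distinct_gf S1 * distinct_gf S1 * distinct_gf E =
        distinct_gf R * (distinct_gf S1 * distinct_gf S4)"
      by (simp add: R E mult_ac)
    ultimately show "distinct_gf S1 * distinct_gf S4 =
        unrestricted_gf R * (distinct_gf S1 * distinct_gf S1 * distinct_gf E)"
      by (metis mult.assoc mult.left_neutral)
    show "distinct_gf S1 * distinct_gf S1 * distinct_gf E * distinct_gf E = distinct_gf (E \<union> L)"
      by (simp only: all mult_ac sq[symmetric])
  qed (use fin in \<open>auto simp: E_def L_def\<close>)
  then show ?thesis
    using Q of_nat_Q of_nat_b4 by (simp add: R_def)
qed

theorem corollary1p2:
  fixes n :: nat
  shows "(even (Q 0 n) \<longleftrightarrow> even (pod n)) \<and> (even (Q 2 n) \<longleftrightarrow> even (b4 n))"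
  using of_nat_Q_0_eq_of_nat_pod[of n] of_nat_Q_2_eq_of_nat_b4[of n]
  by (metis odd_iff_of_nat_bit)

end
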